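(* For all $n\ge1$, $$\sum_{\pi\in T_{2n+1}} \mathrm{sign}(\pi)\, q^{\mathrm{lis}(\pi)}=\sum_{\pi\in T_n} q^{2\,\mathrm{lis}(\pi)+1} \qquad\text{and}\qquad \sum_{\pi\in T_{2n+2}} \mathrm{sign}(\pi)\, q^{\mathrm{lis}(\pi)}=(q-1)\sum_{\pi\in T_n} q^{2\,\mathrm{lis}(\pi)+1}.$$
   Context: $T_n$ denotes the set of $321$-avoiding permutations in the symmetric group $\mathcal S_n$, i.e. permutations with no decreasing subsequence of length three. For a permutation $\pi$, $\mathrm{lis}(\pi)$ is the length of a longest increasing subsequence of $\pi$, and $\mathrm{sign}(\pi)\in\{1,-1\}$ is its sign. $q$ is a formal variable. *)

theory Defs
  imports "HOL-Computational_Algebra.Polynomial" "HOL-Combinatorics.Permutations"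
begin

definition avoids_321 :: "nat \<Rightarrow> (nat \<Rightarrow> nat) \<Rightarrow> bool" where
  "avoids_321 n p \<longleftrightarrow>
     \<not> (\<exists>i\<in>{1..n}. \<exists>j\<in>{1..n}. \<exists>k\<in>{1..n}. i < j \<and> j < k \<and> p i > p j \<and> p j > p k)"

definition T :: "nat \<Rightarrow> (nat \<Rightarrow> nat) set" where
  "T n = {p. p permutes {1..n} \<and> avoids_321 n p}"

text \<open>A subsequence is given by the set of its positions.\<close>

definition lis :: "nat \<Rightarrow> (nat \<Rightarrow> nat) \<Rightarrow> nat" where
  "lis n p = Max (card ` {A. A \<subseteq> {1..n} \<and> strict_mono_on A p})"

abbreviation q :: "int poly" where
  "q \<equiv> [:0, 1:]"

end

theory Submission
  imports Defs
begin

text \<open>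
  A 321-avoiding permutation is dismantled from the bottom left corner of its diagram.  Let
  \<open>T_corner m h h\<close> consist of the 321-avoiding permutations of \<open>{1..m}\<close> with no entry in the
  corner square \<open>{1..h} \<times> {1..h}\<close>.  The value \<open>h + 1\<close> either lies beyond position \<open>h\<close> or is the
  first entry, which can then be removed at the cost of the sign \<open>(-1)\<^sup>h\<close>; inverting the
  permutation, the same holds for position \<open>h + 1\<close> and the value 1.  So the corner grows one row
  and one column at a time.

  To follow the longest increasing subsequence, the first \<open>a\<close> positions and the first \<open>b\<close> values
  are declared unusable, where one of \<open>a\<close>, \<open>b\<close> is 0.  Each removal changes \<open>(h, a, b)\<close> and the length in
  a way that depends on \<open>(h, a, b)\<close> only, so the generating functions satisfy a linear recursion on
  such states.  The theorem follows from an identity between recursions: two signed steps in \<open>q\<close>,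
  applied to the combination \<open>q (2h, 2a, 2b) + (2h + 1, 2a, 2b)\<close> of states, amount to one
  unsigned step in \<open>q\<^sup>2\<close> applied to the state \<open>(h, a, b)\<close>.
\<close>

section \<open>Increasing subsequences beyond a position and a value\<close>

definition incr_beyond :: "nat \<Rightarrow> (nat \<Rightarrow> nat) \<Rightarrow> nat \<Rightarrow> nat \<Rightarrow> nat set \<Rightarrow> bool" where
  "incr_beyond m p a b A \<longleftrightarrow> A \<subseteq> {i \<in> {1..m}. a < i \<and> b < p i} \<and> strict_mono_on A p"

definition lis_beyond :: "nat \<Rightarrow> (nat \<Rightarrow> nat) \<Rightarrow> nat \<Rightarrow> nat \<Rightarrow> nat" where
  "lis_beyond m p a b = Max (card ` {A. incr_beyond m p a b A})"

lemma incr_beyond_finite: "incr_beyond m p a b A \<Longrightarrow> finite A"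
  unfolding incr_beyond_def by (rule finite_subset[of A "{1..m}"]) auto

lemma incr_beyond_subset: "incr_beyond m p a b A \<Longrightarrow> B \<subseteq> A \<Longrightarrow> incr_beyond m p a b B"
  unfolding incr_beyond_def by (meson monotone_on_subset order_trans)

lemma finite_card_incr_beyond: "finite (card ` {A. incr_beyond m p a b A})"
  by (rule finite_imageI, rule finite_subset[of _ "Pow {1..m}"]) (auto simp: incr_beyond_def)

lemma card_le_lis_beyond: "incr_beyond m p a b A \<Longrightarrow> card A \<le> lis_beyond m p a b"
  unfolding lis_beyond_def
  by (rule Max_ge[OF finite_card_incr_beyond]) auto

lemma lis_beyond_attained: obtains A where "incr_beyond m p a b A" "card A = lis_beyond m p a b"
proof -
  have "incr_beyond m p a b {}"
    by (auto simp: incr_beyond_def)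
  then have "lis_beyond m p a b \<in> card ` {A. incr_beyond m p a b A}"
    unfolding lis_beyond_def
    by (intro Max_in finite_card_incr_beyond) auto
  then show ?thesis using that by auto
qed

lemma lis_beyond_leI:
  assumes "\<And>A. incr_beyond m p a b A \<Longrightarrow> card A \<le> k"
  shows "lis_beyond m p a b \<le> k"
  using assms lis_beyond_attained by metis

lemma permutes_interval_bounds:
  fixes p :: "nat \<Rightarrow> nat"
  assumes "p permutes {1..m}" "i \<in> {1..m}"
  shows "1 \<le> p i" "p i \<le> m"
  using permutes_in_image[OF assms(1), of i] assms(2) by simp_all

lemma lis_eq_lis_beyond:
  assumes "p permutes {1..m}"
  shows "lis m p = lis_beyond m p 0 0"
proof -
  have "{i \<in> {1..m}. 0 < i \<and> 0 < p i} = {1..m}"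
    using permutes_interval_bounds(1)[OF assms] by fastforce
  then show ?thesis unfolding lis_def lis_beyond_def incr_beyond_def by simp
qed

lemma incr_beyond_inv:
  assumes p: "p permutes {1..m}" and A: "incr_beyond m p a b A"
  shows "incr_beyond m (inv p) b a (p ` A)" "card (p ` A) = card A"
proof -
  have "strict_mono_on (p ` A) (inv p)"
  proof (rule strict_mono_onI)
    fix u v assume "u \<in> p ` A" "v \<in> p ` A" "u < v"
    then obtain i j where ij: "i \<in> A" "j \<in> A" "u = p i" "v = p j" by auto
    have "strict_mono_on A p" using A by (simp add: incr_beyond_def)
    then have "i < j"
      using strict_mono_onD[of A p j i] ij \<open>u < v\<close> by (cases i j rule: linorder_cases) auto
    then show "inv p u < inv p v" using ij permutes_inverses[OF p] by simp
  qed
  moreover have "p i \<in> {j \<in> {1..m}. b < j \<and> a < inv p j}" if "i \<in> A" for i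
    using A that permutes_interval_bounds[OF p, of i]
    by (auto simp: incr_beyond_def permutes_inverses(2)[OF p])
  ultimately show "incr_beyond m (inv p) b a (p ` A)"
    unfolding incr_beyond_def by blast
  show "card (p ` A) = card A"
    by (intro card_image permutes_inj_on[OF p])
qed

text \<open>Inversion turns an increasing set of positions into its set of values and exchanges the
  two thresholds. Applied to \<open>p\<close> and to \<open>inv p\<close>, this gives both
  inequalities.\<close>

lemma lis_beyond_inv:
  assumes p: "p permutes {1..m}"
  shows "lis_beyond m (inv p) b a = lis_beyond m p a b"
proof (rule antisym)
  have le: "lis_beyond m r a b \<le> lis_beyond m (inv r) b a" if "r permutes {1..m}" for r a b
    by (rule lis_beyond_leI) (metis incr_beyond_inv that card_le_lis_beyond)
  show "lis_beyond m p a b \<le> lis_beyond m (inv p) b a" by (rule le[OF p])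
  show "lis_beyond m (inv p) b a \<le> lis_beyond m p a b"
    using le[OF permutes_inv[OF p]] by (simp add: permutes_inv_inv[OF p])
qed

section \<open>321-avoiding permutations with an empty corner\<close>

definition T_corner :: "nat \<Rightarrow> nat \<Rightarrow> nat \<Rightarrow> (nat \<Rightarrow> nat) set" where
  "T_corner m x y = {p \<in> T m. \<forall>i\<in>{1..x}. y < p i}"

lemma finite_T: "finite (T m)"
  by (rule finite_subset[OF _ finite_permutations[of "{1..m}"]]) (auto simp: T_def)

lemma finite_T_corner: "finite (T_corner m x y)"
  using finite_T by (auto simp: T_corner_def)

lemma T_permutes: "p \<in> T m \<Longrightarrow> p permutes {1..m}"
  by (simp add: T_def)

lemma T_avoidsD:
  assumes "p \<in> T m" "i < j" "j < k" "1 \<le> i" "k \<le> m" "p j < p i" "p k < p j"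
  shows False
proof -
  have "i \<in> {1..m}" "j \<in> {1..m}" "k \<in> {1..m}" using assms by auto
  then show False using assms unfolding T_def avoids_321_def by blast
qed

lemma inv_in_T:
  assumes "p \<in> T m"
  shows "inv p \<in> T m"
proof -
  have p: "p permutes {1..m}" using assms by (rule T_permutes)
  have "False" if "i \<in> {1..m}" "j \<in> {1..m}" "k \<in> {1..m}" "i < j" "j < k"
      "inv p j < inv p i" "inv p k < inv p j" for i j k
  proof (rule T_avoidsD[OF assms that(7) that(6)])
    show "1 \<le> inv p k" "inv p i \<le> m"
      using permutes_interval_bounds[OF permutes_inv[OF p]] that by blast+
  qed (use that in \<open>simp_all add: permutes_inverses[OF p]\<close>)
  then show ?thesis
    using permutes_inv[OF p] unfolding T_def avoids_321_def by blast
qed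

lemma inv_in_T_corner:
  assumes "p \<in> T_corner m x y"
  shows "inv p \<in> T_corner m y x"
proof -
  have p: "p \<in> T m" and c: "\<forall>i\<in>{1..x}. y < p i" using assms by (auto simp: T_corner_def)
  note P = T_permutes[OF p]
  have "x < inv p i" if "i \<in> {1..y}" for i
  proof (rule ccontr)
    assume *: "\<not> x < inv p i"
    \<comment> \<open>The corner condition speaks of positive positions only, so the fixed point 0
      must be excluded.\<close>
    have "inv p i \<noteq> 0"
    proof
      assume "inv p i = 0"
      then have "i = p 0" using permutes_inverses(1)[OF P, of i] by simp
      then show False using that permutes_not_in[OF P, of 0] by simp
    qed
    then have "y < p (inv p i)" using c * by auto
    then show False using that permutes_inverses(1)[OF P] by simp
  qed
  then show ?thesis using inv_in_T[OF p] by (simp add: T_corner_def)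
qed

text \<open>A nonempty corner as large as the diagram would leave no value for the first entry. This
  gives the initial values of the recursion.\<close>

lemma T_corner_diag: "T_corner h h h = (if h = 0 then {id} else {})"
proof (cases "h = 0")
  case True
  then show ?thesis by (auto simp: T_corner_def T_def avoids_321_def permutes_empty)
next
  case False
  have "False" if "p \<in> T_corner h h h" for p
    using that False permutes_interval_bounds(2)[of p h 1]
    by (auto simp: T_corner_def T_def dest!: bspec[of _ _ 1])
  then show ?thesis using False by auto
qed

section \<open>Prepending an entry\<close>

text \<open>The cycle sending 1 to \<open>k + 1\<close> and lowering 2, ..., \<open>k + 1\<close> by
  one, written as \<open>k\<close> adjacent transpositions so that its sign is immediate.\<close>

primrec front_cycle :: "nat \<Rightarrow> nat \<Rightarrow> nat" where
  "front_cycle 0 = id"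
| "front_cycle (Suc k) = transpose (Suc k) (Suc (Suc k)) \<circ> front_cycle k"

lemma front_cycle_permutes: "front_cycle k permutes {1..Suc k}"
proof (induction k)
  case (Suc k)
  have "transpose (Suc k) (Suc (Suc k)) permutes {1..Suc (Suc k)}"
    by (rule permutes_swap_id) auto
  then show ?case
    unfolding front_cycle.simps by (intro permutes_compose[OF permutes_subset[OF Suc]]) auto
qed (simp add: fun_eq_iff)

lemma front_cycle_apply:
  "front_cycle k i = (if i = 0 then 0 else if i = 1 then Suc k else if i \<le> Suc k then i - 1 else i)"
  by (induction k) (auto simp: transpose_def)

lemma sign_front_cycle: "sign (front_cycle k) = (-1) ^ k"
proof (induction k)
  case (Suc k)
  have "permutation (front_cycle k)"
    using front_cycle_permutes permutation_permutes by blast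
  then show ?case
    unfolding front_cycle.simps
    by (subst sign_compose) (simp_all add: Suc permutation_swap_id sign_swap_id)
qed (simp add: sign_id)

text \<open>In one-line notation: \<open>y + 1\<close> is put in front of \<open>p\<close>, whose
  values above \<open>y\<close> are raised by one. The shift by \<open>Suc\<close> makes 1 a fixed
  point, and the cycle then gives it the value \<open>y + 1\<close>.\<close>

definition prepend :: "nat \<Rightarrow> nat \<Rightarrow> (nat \<Rightarrow> nat) \<Rightarrow> nat \<Rightarrow> nat" where
  "prepend m y p = front_cycle y \<circ> map_permutation {1..m} Suc p"

lemma bij_betw_Suc_interval: "bij_betw Suc {1..m} {2..Suc m}"
  by (simp add: bij_betw_def numeral_2_eq_2 image_Suc_atLeastAtMost)

lemma map_permutation_Suc_permutes:
  "p permutes {1..m} \<Longrightarrow> map_permutation {1..m} Suc p permutes {2..Suc m}"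
  by (rule map_permutation_permutes[OF bij_betw_Suc_interval])

lemma prepend_permutes:
  assumes "p permutes {1..m}" "y \<le> m"
  shows "prepend m y p permutes {1..Suc m}"
  unfolding prepend_def
  by (rule permutes_compose[OF permutes_subset[OF map_permutation_Suc_permutes[OF assms(1)]]
        permutes_subset[OF front_cycle_permutes]]) (use assms in auto)

lemma prepend_first:
  assumes "p permutes {1..m}"
  shows "prepend m y p (Suc 0) = Suc y"
  using permutes_not_in[OF map_permutation_Suc_permutes[OF assms], of 1]
  by (simp add: prepend_def front_cycle_apply)

lemma prepend_Suc:
  assumes p: "p permutes {1..m}" and i: "1 \<le> i"
  shows "prepend m y p (Suc i) = (if p i \<le> y then p i else Suc (p i))"
proof -
  have "map_permutation {1..m} Suc p (Suc i) = Suc (p i)"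
  proof (cases "i \<le> m")
    case True
    then show ?thesis using i by (intro map_permutation_apply) auto
  next
    case False
    then show ?thesis
      using permutes_not_in[OF map_permutation_Suc_permutes[OF p], of "Suc i"]
        permutes_not_in[OF p, of i] by simp
  qed
  moreover have "p i \<noteq> 0"
    using i permutes_not_in[OF p, of 0] permutes_inj[OF p] by (metis atLeastAtMost_iff inj_eq not_one_le_zero)
  ultimately show ?thesis by (simp add: prepend_def front_cycle_apply)
qed

lemma sign_prepend:
  assumes p: "p permutes {1..m}"
  shows "sign (prepend m y p) = (-1) ^ y * sign p"
proof -
  have 1: "permutation (front_cycle y)"
    using front_cycle_permutes permutation_permutes by blast
  have 2: "permutation (map_permutation {1..m} Suc p)"
    using map_permutation_Suc_permutes[OF p] permutation_permutes by blast
  have "sign (map_permutation {1..m} Suc p) = sign p"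
    by (rule sign_map_permutation[OF _ p]) auto
  then show ?thesis
    unfolding prepend_def sign_compose[OF 1 2] by (simp add: sign_front_cycle)
qed

lemma prepend_inj:
  assumes p: "p permutes {1..m}" and r: "r permutes {1..m}" and eq: "prepend m y p = prepend m y r"
  shows "p = r"
proof
  fix i show "p i = r i"
  proof (cases "i \<in> {1..m}")
    case True
    then show ?thesis
      using prepend_Suc[OF p, of i y] prepend_Suc[OF r, of i y] eq by (auto split: if_splits)
  qed (simp add: permutes_not_in[OF p] permutes_not_in[OF r])
qed

text \<open>Undoing the cycle leaves a permutation that fixes 1, and this shifts down to
  \<open>{1..m}\<close>.\<close>

lemma prepend_surj:
  assumes p: "p permutes {1..Suc m}" and first: "p 1 = Suc y"
  obtains r where "r permutes {1..m}" "p = prepend m y r"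
proof -
  have ym: "y \<le> m" using permutes_in_image[OF p, of 1] first by auto
  define s where "s = inv (front_cycle y) \<circ> p"
  have cyc: "front_cycle y permutes {1..Suc m}"
    by (rule permutes_subset[OF front_cycle_permutes]) (use ym in auto)
  have s: "s permutes {1..Suc m}"
    unfolding s_def by (rule permutes_compose[OF p permutes_inv[OF cyc]])
  have "s 1 = 1"
    unfolding s_def using first permutes_inv_eq[OF cyc, of "Suc y" 1] by (simp add: front_cycle_apply)
  then have s2: "s permutes {2..Suc m}"
    by (intro permutes_superset[OF s]) (auto simp: not_le less_Suc_eq numeral_2_eq_2)
  have bij: "bij_betw (\<lambda>i. i - 1) {2..Suc m} {1..m}"
    by (rule bij_betw_byWitness[where f' = Suc]) auto
  define r where "r = map_permutation {2..Suc m} (\<lambda>i. i - 1) s"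
  have r: "r permutes {1..m}"
    unfolding r_def by (rule map_permutation_permutes[OF bij s2])
  have "map_permutation {1..m} Suc r = s"
    unfolding r_def by (rule map_permutation_compose_inv[OF bij s2]) auto
  then have "prepend m y r = p"
    unfolding prepend_def s_def using permutes_inv_o(1)[OF cyc] by (simp add: o_assoc)
  with r show ?thesis using that by metis
qed

section \<open>Increasing subsequences after prepending\<close>

lemma prepend_less_iff:
  assumes "p permutes {1..m}" "1 \<le> i" "1 \<le> j"
  shows "prepend m y p (Suc i) < prepend m y p (Suc j) \<longleftrightarrow> p i < p j"
  using prepend_Suc[OF assms(1)] assms(2,3) by auto

lemma less_prepend_iff:
  assumes "p permutes {1..m}" "1 \<le> i" "b \<le> y"
  shows "b < prepend m y p (Suc i) \<longleftrightarrow> b < p i"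
  using prepend_Suc[OF assms(1,2)] assms(3) by auto

lemma incr_beyond_prepend_iff:
  assumes p: "p permutes {1..m}" and b: "b \<le> y"
  shows "incr_beyond (Suc m) (prepend m y p) (Suc a) b (Suc ` A) \<longleftrightarrow> incr_beyond m p a b A"
proof (cases "0 \<in> A")
  case True
  then show ?thesis by (auto simp: incr_beyond_def)
next
  case False
  then have pos: "1 \<le> i" if "i \<in> A" for i using that by (cases i) auto
  have "strict_mono_on (Suc ` A) (prepend m y p) \<longleftrightarrow> strict_mono_on A p"
  proof
    assume "strict_mono_on (Suc ` A) (prepend m y p)"
    then have "prepend m y p (Suc i) < prepend m y p (Suc j)" if "i \<in> A" "j \<in> A" "i < j" for i j
      by (rule strict_mono_onD) (use that in auto)
    then show "strict_mono_on A p"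
      using pos prepend_less_iff[OF p] by (auto intro!: strict_mono_onI)
  next
    assume "strict_mono_on A p"
    then have "prepend m y p (Suc i) < prepend m y p (Suc j)" if "i \<in> A" "j \<in> A" "i < j" for i j
      using strict_mono_onD[of A p i j] prepend_less_iff[OF p] pos that by simp
    then show "strict_mono_on (Suc ` A) (prepend m y p)"
      by (auto intro!: strict_mono_onI)
  qed
  moreover have "Suc ` A \<subseteq> {i \<in> {1..Suc m}. Suc a < i \<and> b < prepend m y p i}
      \<longleftrightarrow> A \<subseteq> {i \<in> {1..m}. a < i \<and> b < p i}"
    using pos less_prepend_iff[OF p _ b] by fastforce
  ultimately show ?thesis unfolding incr_beyond_def by simp
qed

lemma incr_beyond_Suc_imageE:
  assumes "incr_beyond m p (Suc a) b B"
  obtains A where "B = Suc ` A" "card B = card A"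
proof
  have "\<forall>i\<in>B. 0 < i" using assms by (auto simp: incr_beyond_def)
  then show "B = Suc ` (Suc -` B)"
    by (auto simp: image_iff vimage_def) (metis Suc_pred)
  then show "card B = card (Suc -` B)" by (metis card_image inj_Suc inj_on_subset subset_UNIV)
qed

lemma lis_beyond_prepend_Suc:
  assumes p: "p permutes {1..m}" and b: "b \<le> y"
  shows "lis_beyond (Suc m) (prepend m y p) (Suc a) b = lis_beyond m p a b"
proof (rule antisym)
  show "lis_beyond (Suc m) (prepend m y p) (Suc a) b \<le> lis_beyond m p a b"
  proof (rule lis_beyond_leI)
    fix B assume B: "incr_beyond (Suc m) (prepend m y p) (Suc a) b B"
    then obtain A where "B = Suc ` A" "card B = card A" by (rule incr_beyond_Suc_imageE)
    then show "card B \<le> lis_beyond m p a b"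
      using B incr_beyond_prepend_iff[OF p b] card_le_lis_beyond by metis
  qed
  show "lis_beyond m p a b \<le> lis_beyond (Suc m) (prepend m y p) (Suc a) b"
  proof (rule lis_beyond_leI)
    fix A assume "incr_beyond m p a b A"
    then have "card (Suc ` A) \<le> lis_beyond (Suc m) (prepend m y p) (Suc a) b"
      using incr_beyond_prepend_iff[OF p b] card_le_lis_beyond by blast
    then show "card A \<le> lis_beyond (Suc m) (prepend m y p) (Suc a) b"
      by (simp add: card_image)
  qed
qed

text \<open>
  An optimal sequence in \<open>p\<close> with values beyond \<open>b + 1\<close> can be extended in \<open>prepend m y p\<close>:
  by the new first entry \<open>y + 1\<close> if all its values exceed \<open>y\<close>, and otherwise by the value \<open>b + 1\<close>,
  because the values up to \<open>y\<close> occur in increasing order.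
\<close>

lemma lis_beyond_prepend_0:
  assumes p: "p permutes {1..m}" and ym: "y \<le> m" and b: "b \<le> y"
    and small: "\<And>i j. \<lbrakk>i \<in> {1..m}; j \<in> {1..m}; p i < p j; p j \<le> y\<rbrakk> \<Longrightarrow> i < j"
  shows "lis_beyond (Suc m) (prepend m y p) 0 b = Suc (lis_beyond m p 0 (min (Suc b) y))"
    (is "lis_beyond _ ?P _ _ = Suc (lis_beyond _ _ _ ?c)")
proof (rule antisym)
  show "lis_beyond (Suc m) ?P 0 b \<le> Suc (lis_beyond m p 0 ?c)"
  proof (rule lis_beyond_leI)
    fix B assume B: "incr_beyond (Suc m) ?P 0 b B"
    have finB: "finite B" using B by (rule incr_beyond_finite)
    have "incr_beyond (Suc m) ?P (Suc 0) b (B - {1})"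
      using incr_beyond_subset[OF B, of "B - {1}"] unfolding incr_beyond_def by auto
    then obtain A where A: "B - {1} = Suc ` A" "card (B - {1}) = card A" "incr_beyond m p 0 b A"
      by (metis incr_beyond_Suc_imageE incr_beyond_prepend_iff[OF p b])
    have inj: "inj_on p A" using permutes_inj_on[OF p] .
    \<comment> \<open>Since \<open>?c\<close> is at most \<open>b + 1\<close>, passing from
      \<open>A\<close> to \<open>A'\<close> can lose only the entry of value \<open>b + 1\<close>.
      If the new entry is in \<open>B\<close>, all of \<open>A\<close> has values above
      \<open>y\<close> and nothing is lost; if it is not, one loss is affordable.\<close>
    define A' where "A' = {i \<in> A. ?c < p i}"
    have "incr_beyond m p 0 ?c A'"
      using incr_beyond_subset[OF A(3), of A'] unfolding incr_beyond_def A'_def by auto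
    then have le: "card A' \<le> lis_beyond m p 0 ?c" by (rule card_le_lis_beyond)
    have "card B \<le> Suc (card A')"
    proof (cases "1 \<in> B")
      case True
      have "y < p i" if "i \<in> A" for i
      proof -
        have i: "1 \<le> i" "Suc i \<in> B" using A(1,3) that by (auto simp: incr_beyond_def)
        then have "?P 1 < ?P (Suc i)"
          using B True strict_mono_onD[of B ?P 1 "Suc i"] by (auto simp: incr_beyond_def)
        then show ?thesis
          using prepend_first[OF p] prepend_Suc[OF p i(1), of y] by (simp split: if_splits)
      qed
      then have "A' = A" unfolding A'_def by (auto simp: min_less_iff_disj)
      then show ?thesis using A(2) finB True by (simp add: card_Diff_singleton)
    next
      case False
      have "A - A' \<subseteq> {i \<in> A. p i = Suc b}"
        using A(3) unfolding A'_def incr_beyond_def by fastforce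
      moreover have "card {i \<in> A. p i = Suc b} \<le> 1"
        using inj by (auto simp: card_le_Suc0_iff_eq incr_beyond_finite[OF A(3)] inj_on_def)
      ultimately have "card (A - A') \<le> 1"
        using card_mono[of "{i \<in> A. p i = Suc b}" "A - A'"] incr_beyond_finite[OF A(3)] by simp
      moreover have "card A = card A' + card (A - A')"
        using incr_beyond_finite[OF A(3)] card_Int_Diff[of A A'] by (simp add: A'_def Int_def cong: conj_cong)
      ultimately show ?thesis using False A(2) by simp
    qed
    then show "card B \<le> Suc (lis_beyond m p 0 ?c)" using le by simp
  qed
  show "Suc (lis_beyond m p 0 ?c) \<le> lis_beyond (Suc m) ?P 0 b"
  proof -
    obtain A where A: "incr_beyond m p 0 ?c A" "card A = lis_beyond m p 0 ?c"
      by (rule lis_beyond_attained)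
    have finA: "finite A" using A(1) by (rule incr_beyond_finite)
    have sub: "A \<subseteq> {1..m}" and mono: "strict_mono_on A p" and big: "\<And>i. i \<in> A \<Longrightarrow> ?c < p i"
      using A(1) by (auto simp: incr_beyond_def)
    show ?thesis
    proof (cases "\<forall>i\<in>A. y < p i")
      case True
      let ?B = "insert 1 (Suc ` A)"
      have *: "Suc y < ?P (Suc i)" "b < p i" if "i \<in> A" for i
        using prepend_Suc[OF p, of i y] True that sub b by force+
      have "incr_beyond m p 0 b A"
        using A(1) *(2) unfolding incr_beyond_def by auto
      then have "incr_beyond (Suc m) ?P (Suc 0) b (Suc ` A)"
        using incr_beyond_prepend_iff[OF p b] by simp
      then have "incr_beyond (Suc m) ?P 0 b ?B"
        unfolding incr_beyond_def strict_mono_on_def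
        using prepend_first[OF p, of y] *(1) b by auto
      then have "card ?B \<le> lis_beyond (Suc m) ?P 0 b" by (rule card_le_lis_beyond)
      moreover have "1 \<notin> Suc ` A" using sub by auto
      ultimately show ?thesis using finA A(2) by (simp add: card_image)
    next
      case False
      then obtain i0 where i0: "i0 \<in> A" "p i0 \<le> y" by auto
      \<comment> \<open>A value of \<open>A\<close> that is at most \<open>y\<close> but above
        \<open>?c\<close> forces \<open>?c < y\<close>, so the minimum is \<open>b + 1\<close>. The
        entry of that value is the one to add.\<close>
      then have c: "?c = Suc b" "Suc b \<le> m" using big[of i0] ym by auto
      define j where "j = inv p (Suc b)"
      have pj: "p j = Suc b" unfolding j_def by (rule permutes_inverses(1)[OF p])
      have j: "j \<in> {1..m}"
        unfolding j_def using permutes_interval_bounds[OF permutes_inv[OF p], of "Suc b"] c by simp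
      have "j < i0"
        using small[of j i0] j i0 sub big[of i0] c pj by auto
      \<comment> \<open>Values up to \<open>y\<close> occur in increasing order, hence after
        \<open>j\<close>; the larger values in \<open>A\<close> come after
        \<open>i0\<close>.\<close>
      have before: "j < i" if "i \<in> A" for i
      proof (cases "p i \<le> y")
        case True
        then show ?thesis using small[of j i] j that sub big[of i] c pj by auto
      next
        case False
        then have "i0 \<le> i"
          using strict_mono_onD[OF mono, of i i0] that i0 by (meson leI le_trans less_imp_le)
        then show ?thesis using \<open>j < i0\<close> by simp
      qed
      let ?B = "Suc ` insert j A"
      have "incr_beyond m p 0 b (insert j A)"
        using A(1) before big pj j c unfolding incr_beyond_def strict_mono_on_def
        by (auto dest: Suc_lessD) (meson before order_less_asym)
      then have "incr_beyond (Suc m) ?P (Suc 0) b ?B"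
        using incr_beyond_prepend_iff[OF p b] by blast
      then have "incr_beyond (Suc m) ?P 0 b ?B"
        unfolding incr_beyond_def by auto
      then have "card ?B \<le> lis_beyond (Suc m) ?P 0 b" by (rule card_le_lis_beyond)
      moreover have "card ?B = Suc (card A)"
        using before finA by (subst card_image) (auto simp: card_insert_if)
      ultimately show ?thesis using A(2) by simp
    qed
  qed
qed

section \<open>Splitting off the first entry\<close>

text \<open>If \<open>x\<close> is positive, the first entry exceeds \<open>y\<close> and would
  complete an inversion among the values up to \<open>y\<close> to a 321 pattern. If
  \<open>x = 0\<close>, then \<open>y \<le> 1\<close> and there are no two such values.\<close>

lemma T_corner_small_increasing:
  assumes p: "p \<in> T_corner m x y" and xy: "y = x \<or> y = Suc x"
    and ij: "i \<in> {1..m}" "j \<in> {1..m}" "p i < p j" "p j \<le> y"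
  shows "i < j"
proof (rule ccontr)
  assume "\<not> i < j"
  then have "j < i" using ij(3) by (cases i j rule: linorder_cases) auto
  have pT: "p \<in> T m" and corner: "\<forall>i\<in>{1..x}. y < p i" using p by (auto simp: T_corner_def)
  have "1 \<le> p i" using permutes_interval_bounds(1)[OF T_permutes[OF pT] ij(1)] .
  then have "1 \<le> x" using xy ij(3,4) by auto
  then have 1: "y < p 1" using corner by auto
  then have "1 < j" using ij by (cases "j = 1") auto
  then show False
    using T_avoidsD[OF pT, of 1 j i] \<open>j < i\<close> 1 ij by auto
qed

text \<open>A 321 pattern that uses the new entry would need an inversion of \<open>p\<close> among
  the values up to \<open>y\<close>; any other one already lies in \<open>p\<close>.\<close>

lemma prepend_in_T_corner:
  assumes p: "p \<in> T_corner m x y" and xy: "y = x \<or> y = Suc x" and ym: "y \<le> m"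
  shows "prepend m y p \<in> T_corner (Suc m) (Suc x) y"
proof -
  have pT: "p \<in> T m" and corner: "\<forall>i\<in>{1..x}. y < p i" using p by (auto simp: T_corner_def)
  note P = T_permutes[OF pT]
  let ?P = "prepend m y p"
  have False if "i \<in> {1..Suc m}" "j \<in> {1..Suc m}" "k \<in> {1..Suc m}" "i < j" "j < k"
      "?P j < ?P i" "?P k < ?P j" for i j k
  proof -
    define j' k' where "j' = j - 1" and "k' = k - 1"
    with that have jk: "j = Suc j'" "k = Suc k'" "1 \<le> j'" "1 \<le> k'" by auto
    have kj: "p k' < p j'" using that jk prepend_less_iff[OF P] by blast
    show False
    proof (cases "i = 1")
      case True
      then have "p j' \<le> y"
        using that(6) prepend_first[OF P, of y] prepend_Suc[OF P jk(3), of y] jk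
        by (simp split: if_splits)
      then have "k' < j'"
        using T_corner_small_increasing[OF p xy, of k' j'] kj jk that by auto
      then show False using that jk by simp
    next
      case False
      define i' where "i' = i - 1"
      with False \<open>i \<in> {1..Suc m}\<close> have i: "i = Suc i'" "1 \<le> i'" by auto
      have "p j' < p i'" using that i jk prepend_less_iff[OF P] by blast
      then show False using T_avoidsD[OF pT, of i' j' k'] kj i jk that by auto
    qed
  qed
  then have "?P \<in> T (Suc m)"
    using prepend_permutes[OF P ym] unfolding T_def avoids_321_def by blast
  moreover have "y < ?P i" if "i \<in> {1..Suc x}" for i
  proof (cases "i = 1")
    case True
    then show ?thesis using prepend_first[OF P] by simp
  next
    case False
    define i' where "i' = i - 1"
    with False \<open>i \<in> {1..Suc x}\<close> have "i = Suc i'" "i' \<in> {1..x}" by auto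
    then show ?thesis using corner less_prepend_iff[OF P, of i' y y] by simp
  qed
  ultimately show ?thesis by (simp add: T_corner_def)
qed

text \<open>Otherwise \<open>y + 1\<close> sits at a position from 2 to \<open>x + 1\<close>, after
  a larger first entry. The value 1 lies beyond position \<open>x + 1\<close> because the corner is
  empty, so it completes a 321 pattern.\<close>

lemma T_corner_first_eq:
  assumes s: "s \<in> T_corner (Suc m) (Suc x) y" "s \<notin> T_corner (Suc m) (Suc x) (Suc y)"
    and xy: "y = x \<or> y = Suc x" and ym: "y \<le> m"
  shows "s 1 = Suc y"
proof -
  have sT: "s \<in> T (Suc m)" and corner: "\<forall>i\<in>{1..Suc x}. y < s i" using s(1) by (auto simp: T_corner_def)
  note S = T_permutes[OF sT]
  obtain i where i: "i \<in> {1..Suc x}" "\<not> Suc y < s i"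
    using s by (auto simp: T_corner_def)
  then have si: "s i = Suc y" using corner by (simp add: Suc_le_eq le_antisym not_less)
  show ?thesis
  proof (cases "i = 1")
    case False
    then have y1: "1 \<le> y" using i xy by auto
    define k where "k = inv s 1"
    have sk: "s k = 1" unfolding k_def by (rule permutes_inverses(1)[OF S])
    have k: "k \<in> {1..Suc m}"
      unfolding k_def using permutes_interval_bounds[OF permutes_inv[OF S], of 1] by simp
    have "Suc x < k" using corner[rule_format, of k] sk k y1 by (cases "k \<le> Suc x") auto
    moreover have "s 1 \<noteq> s i" using False permutes_inj[OF S] by (simp add: inj_eq)
    moreover have "y < s 1" using corner by simp
    ultimately have False
      using T_avoidsD[OF sT, of 1 i k] i False si sk k y1 by auto
    then show ?thesis ..
  qed (use si in simp)
qed

lemma T_corner_eq_prepend: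
  assumes s: "s \<in> T_corner (Suc m) (Suc x) y" "s 1 = Suc y"
  obtains p where "p \<in> T_corner m x y" "s = prepend m y p"
proof -
  have sT: "s \<in> T (Suc m)" and corner: "\<forall>i\<in>{1..Suc x}. y < s i" using s(1) by (auto simp: T_corner_def)
  obtain p where P: "p permutes {1..m}" and sp: "s = prepend m y p"
    using prepend_surj[OF T_permutes[OF sT] s(2)] .
  have False if "i \<in> {1..m}" "j \<in> {1..m}" "k \<in> {1..m}" "i < j" "j < k"
      "p j < p i" "p k < p j" for i j k
    using T_avoidsD[OF sT, of "Suc i" "Suc j" "Suc k"] that prepend_less_iff[OF P, of _ _ y]
    by (simp add: sp)
  then have "p \<in> T m" using P unfolding T_def avoids_321_def by blast
  moreover have "y < p i" if "i \<in> {1..x}" for i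
    using corner[rule_format, of "Suc i"] less_prepend_iff[OF P, of i y y] that by (simp add: sp)
  ultimately have "p \<in> T_corner m x y" by (simp add: T_corner_def)
  then show ?thesis using sp by (rule that)
qed

text \<open>The two choices of \<open>y\<close> are the alternating growth steps: from an
  \<open>x + 1\<close> by \<open>x\<close> rectangle to a square, and from a square to the next
  rectangle.\<close>

lemma T_corner_split:
  assumes "y = x \<or> y = Suc x" "y \<le> m"
  shows "T_corner (Suc m) (Suc x) y = T_corner (Suc m) (Suc x) (Suc y) \<union> prepend m y ` T_corner m x y"
    (is "?L = ?R1 \<union> ?R2")
proof
  show "?L \<subseteq> ?R1 \<union> ?R2"
  proof
    fix s assume s: "s \<in> ?L"
    show "s \<in> ?R1 \<union> ?R2"
    proof (cases "s \<in> ?R1")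
      case False
      from T_corner_eq_prepend[OF s T_corner_first_eq[OF s False assms]] show ?thesis by blast
    qed simp
  qed
  have "?R1 \<subseteq> ?L" by (auto simp: T_corner_def dest: Suc_lessD)
  then show "?R1 \<union> ?R2 \<subseteq> ?L" using prepend_in_T_corner[OF _ assms] by auto
qed

section \<open>Generating functions of the corner classes\<close>

text \<open>The parameter \<open>e\<close> lets one recursion serve both the signed sums
  (\<open>e = -1\<close>) and the unsigned ones (\<open>e = 1\<close>).\<close>

definition weight :: "int \<Rightarrow> (nat \<Rightarrow> nat) \<Rightarrow> int" where
  "weight e p = (if e = -1 then sign p else 1)"

definition corner_gf :: "int \<Rightarrow> int poly \<Rightarrow> nat \<Rightarrow> nat \<Rightarrow> nat \<Rightarrow> nat \<Rightarrow> nat \<Rightarrow> int poly" where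
  "corner_gf e z m x y a b = (\<Sum>p\<in>T_corner m x y. of_int (weight e p) * z ^ lis_beyond m p a b)"

text \<open>Inversion preserves the sign and transposes the diagram, so splitting off the first
  entry also covers splitting off the value 1.\<close>

lemma corner_gf_swap: "corner_gf e z m x y a b = corner_gf e z m y x b a"
  unfolding corner_gf_def
proof (rule sum.reindex_bij_witness[where i = inv and j = inv])
  fix p assume pC: "p \<in> T_corner m x y"
  then have p: "p permutes {1..m}" by (simp add: T_corner_def T_def)
  show "inv (inv p) = p" by (rule permutes_inv_inv[OF p])
  show "inv p \<in> T_corner m y x" by (rule inv_in_T_corner[OF pC])
  have "permutation p" using p permutation_permutes by blast
  then show "of_int (weight e (inv p)) * z ^ lis_beyond m (inv p) b a
      = of_int (weight e p) * z ^ lis_beyond m p a b"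
    by (simp add: weight_def sign_inverse lis_beyond_inv[OF p])
next
  fix p assume pC: "p \<in> T_corner m y x"
  then have p: "p permutes {1..m}" by (simp add: T_corner_def T_def)
  show "inv (inv p) = p" by (rule permutes_inv_inv[OF p])
  show "inv p \<in> T_corner m x y" by (rule inv_in_T_corner[OF pC])
qed

text \<open>Either \<open>y + 1\<close> lies beyond position \<open>x + 1\<close>, or it is the
  first entry. Removing that entry costs the sign factor, and a factor \<open>z\<close> exactly when
  position 1 is usable.\<close>

lemma corner_gf_split:
  assumes xy: "y = x \<or> y = Suc x" and ym: "y \<le> m" and b: "b \<le> y"
    and e: "e = 1 \<or> e = -1"
  shows "corner_gf e z (Suc m) (Suc x) y a b = corner_gf e z (Suc m) (Suc x) (Suc y) a b
    + of_int e ^ y * (if 0 < a then corner_gf e z m x y (a - 1) b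
                      else z * corner_gf e z m x y 0 (min (Suc b) y))"
proof -
  let ?f = "\<lambda>m a b p. of_int (weight e p) * z ^ lis_beyond m p a b"
  let ?C = "T_corner m x y"
  have perm: "p permutes {1..m}" if "p \<in> ?C" for p
    using that by (simp add: T_corner_def T_def)
  have "T_corner (Suc m) (Suc x) (Suc y) \<inter> prepend m y ` ?C = {}"
  proof -
    have "prepend m y p \<notin> T_corner (Suc m) (Suc x) (Suc y)" if "p \<in> ?C" for p
      using prepend_first[OF perm[OF that], of y] by (auto simp: T_corner_def intro!: bexI[of _ 1])
    then show ?thesis by blast
  qed
  then have "corner_gf e z (Suc m) (Suc x) y a b = corner_gf e z (Suc m) (Suc x) (Suc y) a b
      + (\<Sum>p\<in>prepend m y ` ?C. ?f (Suc m) a b p)"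
    unfolding corner_gf_def T_corner_split[OF xy ym]
    by (intro sum.union_disjoint) (auto simp: finite_T_corner)
  also have "(\<Sum>p\<in>prepend m y ` ?C. ?f (Suc m) a b p) = (\<Sum>p\<in>?C. ?f (Suc m) a b (prepend m y p))"
  proof -
    have "inj_on (prepend m y) ?C" by (rule inj_onI) (rule prepend_inj[OF perm perm])
    then show ?thesis by (simp add: sum.reindex)
  qed
  also have "\<dots> = (\<Sum>p\<in>?C. of_int e ^ y * (if 0 < a then ?f m (a - 1) b p
                                                  else z * ?f m 0 (min (Suc b) y) p))"
  proof (rule sum.cong[OF refl])
    fix p assume p: "p \<in> ?C"
    have w: "weight e (prepend m y p) = e ^ y * weight e p"
      using e sign_prepend[OF perm[OF p]] by (auto simp: weight_def)
    show "?f (Suc m) a b (prepend m y p)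
        = of_int e ^ y * (if 0 < a then ?f m (a - 1) b p else z * ?f m 0 (min (Suc b) y) p)"
    proof (cases a)
      case 0
      have "lis_beyond (Suc m) (prepend m y p) 0 b = Suc (lis_beyond m p 0 (min (Suc b) y))"
        by (rule lis_beyond_prepend_0[OF perm[OF p] ym b T_corner_small_increasing[OF p xy]])
      then show ?thesis using 0 by (simp add: w)
    next
      case (Suc a')
      then show ?thesis using lis_beyond_prepend_Suc[OF perm[OF p] b, of a'] by (simp add: w)
    qed
  qed
  also have "\<dots> = of_int e ^ y * (if 0 < a then corner_gf e z m x y (a - 1) b
                      else z * corner_gf e z m x y 0 (min (Suc b) y))"
    unfolding corner_gf_def by (cases "0 < a") (simp_all add: sum_distrib_left)
  finally show ?thesis .
qed

section \<open>The recursion on states\<close>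

type_synonym state_fun = "nat \<Rightarrow> nat \<Rightarrow> nat \<Rightarrow> int poly"

text \<open>If \<open>f\<close> describes \<open>h\<close> by \<open>h\<close> corners in size
  \<open>N + h\<close>, this describes \<open>h\<close> by \<open>h + 1\<close> corners in size
  \<open>N + 1 + h\<close>. The last term removes the value 1 at position
  \<open>h + 1\<close>.\<close>

definition half_step :: "int \<Rightarrow> int poly \<Rightarrow> state_fun \<Rightarrow> state_fun" where
  "half_step e z f h a b = f (Suc h) a b
     + of_int e ^ h * (if 0 < b then f h a (b - 1) else z * f h (min (Suc a) h) 0)"

text \<open>Returns from the \<open>h\<close> by \<open>h + 1\<close> corner to the square by adding
  the permutations that start with \<open>h + 1\<close>. For \<open>h = 0\<close> both corners are
  empty and nothing is added.\<close>

definition full_step :: "int \<Rightarrow> int poly \<Rightarrow> state_fun \<Rightarrow> state_fun" where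
  "full_step e z f h a b = half_step e z f h a b
     + (if h = 0 then 0
        else of_int e ^ h * (if 0 < a then half_step e z f (h - 1) (a - 1) b
                             else z * half_step e z f (h - 1) 0 (min (Suc b) h)))"

text \<open>The index \<open>N\<close> is the size minus the side of the corner. At
  \<open>N = 0\<close> the corner fills the diagram, so only \<open>h = 0\<close>
  contributes.\<close>

definition steps :: "int \<Rightarrow> int poly \<Rightarrow> nat \<Rightarrow> state_fun" where
  "steps e z N = (full_step e z ^^ N) (\<lambda>h a b. if h = 0 then 1 else 0)"

lemma steps_Suc: "steps e z (Suc N) = full_step e z (steps e z N)"
  by (simp add: steps_def)

lemma corner_gf_eq_steps:
  assumes e: "e = 1 \<or> e = -1"
  shows "\<lbrakk>a \<le> h; b \<le> h; a = 0 \<or> b = 0\<rbrakk> \<Longrightarrow> corner_gf e z (N + h) h h a b = steps e z N h a b"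
proof (induction N arbitrary: h a b)
  case 0
  have "lis_beyond 0 id a b = 0"
    by (rule antisym[OF lis_beyond_leI]) (auto simp: incr_beyond_def)
  then show ?case by (simp add: corner_gf_def T_corner_diag steps_def weight_def)
next
  case (Suc N)
  \<comment> \<open>The bound on \<open>b\<close> is \<open>Suc h\<close> because the rectangle
    reaches up to value \<open>h + 1\<close>; the full step does call on that extreme.\<close>
  have half: "corner_gf e z (Suc N + h) h (Suc h) a b = half_step e z (steps e z N) h a b"
    if ab: "a \<le> h" "b \<le> Suc h" "a = 0 \<or> b = 0" for h a b
  proof -
    have "corner_gf e z (Suc N + h) h (Suc h) a b = corner_gf e z (Suc (N + h)) (Suc h) h b a"
      by (subst corner_gf_swap) simp
    also have "\<dots> = corner_gf e z (N + Suc h) (Suc h) (Suc h) b a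
        + of_int e ^ h * (if 0 < b then corner_gf e z (N + h) h h (b - 1) a
                          else z * corner_gf e z (N + h) h h 0 (min (Suc a) h))"
      by (subst corner_gf_split) (use ab e in auto)
    also have "corner_gf e z (N + Suc h) (Suc h) (Suc h) b a = steps e z N (Suc h) a b"
      by (subst corner_gf_swap, rule Suc.IH) (use ab in auto)
    also have "corner_gf e z (N + h) h h (b - 1) a = steps e z N h a (b - 1)"
      by (subst corner_gf_swap, rule Suc.IH) (use ab in auto)
    also have "corner_gf e z (N + h) h h 0 (min (Suc a) h) = steps e z N h (min (Suc a) h) 0"
      by (subst corner_gf_swap, rule Suc.IH) (use ab in auto)
    finally show ?thesis by (simp add: half_step_def)
  qed
  show ?case
  proof (cases h)
    case 0
    have "corner_gf e z (Suc N) 0 0 0 0 = corner_gf e z (Suc N) 0 (Suc 0) 0 0"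
      unfolding corner_gf_def
      by (rule sum.cong) (auto simp: T_corner_def)
    then show ?thesis using half[of 0 0 0] 0 Suc.prems by (simp add: steps_Suc full_step_def)
  next
    case (Suc h')
    have "corner_gf e z (Suc N + h) h h a b = corner_gf e z (Suc N + h) h (Suc h) a b
        + of_int e ^ h * (if 0 < a then corner_gf e z (Suc N + h') h' h (a - 1) b
                          else z * corner_gf e z (Suc N + h') h' h 0 (min (Suc b) h))"
      using corner_gf_split[of h h' "Suc N + h'" b e z a] Suc.prems e Suc by simp
    also have "corner_gf e z (Suc N + h) h (Suc h) a b = half_step e z (steps e z N) h a b"
      by (rule half) (use Suc.prems in auto)
    also have "corner_gf e z (Suc N + h') h' h 0 (min (Suc b) h)
        = half_step e z (steps e z N) h' 0 (min (Suc b) h)"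
      unfolding Suc by (rule half) auto
    also have "(if 0 < a then corner_gf e z (Suc N + h') h' h (a - 1) b else w)
        = (if 0 < a then half_step e z (steps e z N) h' (a - 1) b else w)" for w
      using half[of "a - 1" h' b] Suc.prems Suc by auto
    finally show ?thesis by (simp add: steps_Suc full_step_def Suc)
  qed
qed

section \<open>Two signed steps against one unsigned step\<close>

text \<open>Both sides are expanded and the states of odd side with even thresholds are eliminated
  by \<open>rel\<close>; the remaining values of \<open>f\<close> then cancel through the
  alternating signs. The factor \<open>c\<close> is left free to cover both parities of the number
  of steps.\<close>

lemma full_step_twice:
  fixes f g :: state_fun and z c :: "int poly"
  assumes rel: "\<And>h a b. \<lbrakk>a \<le> h; b \<le> h; a = 0 \<or> b = 0\<rbrakk> \<Longrightarrow>
      z * f (2 * h) (2 * a) (2 * b) + f (2 * h + 1) (2 * a) (2 * b) = c * g h a b"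
    and ab: "a \<le> h" "b \<le> h" "a = 0 \<or> b = 0"
  shows "z * full_step (-1) z (full_step (-1) z f) (2 * h) (2 * a) (2 * b)
       + full_step (-1) z (full_step (-1) z f) (2 * h + 1) (2 * a) (2 * b)
     = c * full_step 1 (z\<^sup>2) g h a b"
proof -
  have rel': "f (Suc (2 * h)) (2 * a) (2 * b) = c * g h a b - z * f (2 * h) (2 * a) (2 * b)"
    if "a \<le> h" "b \<le> h" "a = 0 \<or> b = 0" for h a b
    using rel[OF that] by (simp add: algebra_simps)
  \<comment> \<open>These cases decide the tests for positive thresholds, the exception at
    \<open>h = 0\<close>, and the minima, which saturate once a threshold reaches
    \<open>h\<close>.\<close>
  consider "h = 0" | k where "h = Suc k" "a = 0" "b = 0"
    | k b' where "h = Suc k" "a = 0" "b = Suc b'" "b' < k"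
    | k where "h = Suc k" "a = 0" "b = Suc k"
    | k a' where "h = Suc k" "b = 0" "a = Suc a'" "a' < k"
    | k where "h = Suc k" "b = 0" "a = Suc k"
    using ab by (cases h; cases a; cases b) (auto simp: le_less)
  then show ?thesis
  proof cases
    case 1
    then show ?thesis using ab rel'[of 0 0 0] rel'[of 0 1 0]
      by (simp add: full_step_def half_step_def min_def eval_nat_numeral)
        (simp add: algebra_simps power2_eq_square)
  next
    case (2 k)
    then show ?thesis
      using rel'[of 0 k 0] rel'[of 0 "Suc k" 0] rel'[of 0 "Suc (Suc k)" 0]
       rel'[of 1 "Suc k" 0] rel'[of 0 "Suc k" 1]
      by (simp add: full_step_def half_step_def min_def numeral_2_eq_2)
        (simp add: algebra_simps power2_eq_square)
  next
    case (3 k b)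
    then show ?thesis
      using rel'[of 0 k b] rel'[of 0 k "Suc b"] rel'[of 0 "Suc k" "Suc b"] rel'[of 0 "Suc (Suc k)" "Suc b"]
       rel'[of 0 "Suc k" b] rel'[of 0 "Suc k" "Suc (Suc b)"]
      by (simp add: full_step_def half_step_def min_def)
        (simp add: algebra_simps power2_eq_square)
  next
    case (4 k)
    then show ?thesis
      using rel'[of 0 k k] rel'[of 0 "Suc k" "Suc k"] rel'[of 0 "Suc (Suc k)" "Suc k"]
       rel'[of 0 "Suc k" k]
      by (simp add: full_step_def half_step_def min_def)
        (simp add: algebra_simps power2_eq_square)
  next
    case (5 k b)
    then show ?thesis
      using rel'[of b k 0] rel'[of "Suc b" k 0] rel'[of "Suc b" "Suc k" 0] rel'[of "Suc b" "Suc (Suc k)" 0]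
       rel'[of b "Suc k" 0] rel'[of "Suc (Suc b)" "Suc k" 0]
      by (simp add: full_step_def half_step_def min_def)
        (simp add: algebra_simps power2_eq_square)
  next
    case (6 k)
    then show ?thesis
      using rel'[of k k 0] rel'[of "Suc k" "Suc k" 0] rel'[of "Suc k" "Suc (Suc k)" 0]
       rel'[of k "Suc k" 0]
      by (simp add: full_step_def half_step_def min_def)
        (simp add: algebra_simps power2_eq_square)
  qed
qed

text \<open>The initial function satisfies the relation with \<open>c = z\<close>, as it vanishes
  for positive \<open>h\<close>; each pair of signed steps preserves it.\<close>

lemma steps_double:
  fixes z :: "int poly"
  assumes "a \<le> h" "b \<le> h" "a = 0 \<or> b = 0"
  shows "z * steps (-1) z (2 * n) (2 * h) (2 * a) (2 * b)
       + steps (-1) z (2 * n) (2 * h + 1) (2 * a) (2 * b) = z * steps 1 (z\<^sup>2) n h a b"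
  using assms
proof (induction n arbitrary: h a b)
  case 0
  then show ?case by (simp add: steps_def)
next
  case (Suc n)
  have "2 * Suc n = Suc (Suc (2 * n))" by simp
  then show ?case
    unfolding steps_Suc by (simp only: steps_Suc) (intro full_step_twice Suc)
qed

text \<open>The same induction started after one signed step. That step has the values
  \<open>z\<close> at state (0, 0, 0) and \<open>-z\<close> at (1, 0, 0), so the combination starts
  at \<open>z * z - z\<close>, whence the factor \<open>z - 1\<close>.\<close>

lemma steps_double_odd:
  fixes z :: "int poly"
  assumes "a \<le> h" "b \<le> h" "a = 0 \<or> b = 0"
  shows "z * steps (-1) z (2 * n + 1) (2 * h) (2 * a) (2 * b)
       + steps (-1) z (2 * n + 1) (2 * h + 1) (2 * a) (2 * b) = z * (z - 1) * steps 1 (z\<^sup>2) n h a b"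
  using assms
proof (induction n arbitrary: h a b)
  case 0
  then show ?case
    by (cases h) (simp_all add: steps_def full_step_def half_step_def algebra_simps)
next
  case (Suc n)
  have "2 * Suc n + 1 = Suc (Suc (2 * n + 1))" by simp
  then show ?case
    unfolding steps_Suc by (simp only: steps_Suc) (intro full_step_twice Suc)
qed

section \<open>Sums over all 321-avoiding permutations\<close>

lemma sum_T_eq_steps:
  assumes "e = 1 \<or> e = -1"
  shows "(\<Sum>p\<in>T m. of_int (weight e p) * z ^ lis m p) = steps e z m 0 0 0"
proof -
  have "(\<Sum>p\<in>T m. of_int (weight e p) * z ^ lis m p) = corner_gf e z (m + 0) 0 0 0 0"
    unfolding corner_gf_def
    by (rule sum.cong) (auto simp: T_corner_def lis_eq_lis_beyond[OF T_permutes])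
  also have "\<dots> = steps e z m 0 0 0" by (rule corner_gf_eq_steps) (use assms in auto)
  finally show ?thesis .
qed

theorem theorem1p1:
  fixes n :: nat
  assumes "n \<ge> 1"
  shows "(\<Sum>\<pi>\<in>T (2 * n + 1). of_int (sign \<pi>) * q ^ lis (2 * n + 1) \<pi>)
           = (\<Sum>\<pi>\<in>T n. q ^ (2 * lis n \<pi> + 1))
       \<and> (\<Sum>\<pi>\<in>T (2 * n + 2). of_int (sign \<pi>) * q ^ lis (2 * n + 2) \<pi>)
           = (q - 1) * (\<Sum>\<pi>\<in>T n. q ^ (2 * lis n \<pi> + 1))"
proof -
  have signed: "(\<Sum>\<pi>\<in>T m. of_int (sign \<pi>) * q ^ lis m \<pi>) = steps (-1) q m 0 0 0" for m
    using sum_T_eq_steps[of "-1" q m] by (simp add: weight_def)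
  \<comment> \<open>One step unfolds state (0, 0, 0) into exactly the combination controlled by the
    doubling lemmas at \<open>h = 0\<close>. Hence sizes \<open>2 * n + 1\<close> and
    \<open>2 * n + 2\<close> call for \<open>2 * n\<close> and \<open>2 * n + 1\<close>
    steps.\<close>
  have first: "steps (-1) q (Suc m) 0 0 0 = q * steps (-1) q m 0 0 0 + steps (-1) q m 1 0 0" for m
    by (simp add: steps_Suc full_step_def half_step_def)
  have "(\<Sum>\<pi>\<in>T n. q ^ (2 * lis n \<pi> + 1)) = q * (\<Sum>\<pi>\<in>T n. (q\<^sup>2) ^ lis n \<pi>)"
    unfolding sum_distrib_left power_mult[symmetric] by (simp only: Suc_eq_plus1[symmetric] power_Suc)
  also have "(\<Sum>\<pi>\<in>T n. (q\<^sup>2) ^ lis n \<pi>) = steps 1 (q\<^sup>2) n 0 0 0"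
    using sum_T_eq_steps[of 1 "q\<^sup>2" n] by (simp add: weight_def)
  finally have doubled: "(\<Sum>\<pi>\<in>T n. q ^ (2 * lis n \<pi> + 1)) = q * steps 1 (q\<^sup>2) n 0 0 0" .
  have "steps (-1) q (2 * n + 1) 0 0 0 = q * steps 1 (q\<^sup>2) n 0 0 0"
    using first[of "2 * n"] steps_double[of 0 0 0 q n] by simp
  moreover have "steps (-1) q (2 * n + 2) 0 0 0 = (q - 1) * (q * steps 1 (q\<^sup>2) n 0 0 0)"
    using first[of "2 * n + 1"] steps_double_odd[of 0 0 0 q n] by (simp only: mult.assoc mult.left_commute) simp
  ultimately show ?thesis
    unfolding signed doubled by simp
qed

end
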